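(* Let $n\ge 2$, $Q=I-\frac1nJ$, and for $z=(z_1,\dots,z_n)\in\mathbb{C}^n$ let $T(z)=Q\,\mathrm{diag}(z_1,\dots,z_n)\,Q$. For every $z\in\mathbb{C}^n$ with $\sum_{j=1}^n z_j=0$, \[ \|T(z)\|_{S_1}\le\sqrt{\frac{n-2}{n}}\;\sum_{j=1}^n|z_j| . \]
   Context: $I$ is the $n\times n$ identity matrix and $J$ the $n\times n$ all-ones matrix. For an $n\times n$ complex matrix $X$ with singular values $\sigma_1(X)\ge\dots\ge\sigma_n(X)$, the Schatten $p$-norm is $\|X\|_{S_p}=(\sum_k\sigma_k(X)^p)^{1/p}$ for $1\le p<\infty$; in particular $\|X\|_{S_1}=\sum_k\sigma_k(X)$ (the trace norm). *)

theory Defs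
  imports "Jordan_Normal_Form.Schur_Decomposition" "HOL-Computational_Algebra.Polynomial"
begin

definition ones_mat :: "nat \<Rightarrow> complex mat" where
  "ones_mat n = Matrix.mat n n (\<lambda>_. 1)"

definition Qmat :: "nat \<Rightarrow> complex mat" where
  "Qmat n = 1\<^sub>m n - (1 / of_nat n) \<cdot>\<^sub>m ones_mat n"

definition Tmat :: "nat \<Rightarrow> complex vec \<Rightarrow> complex mat" where
  "Tmat n z = Qmat n * mat_diag n (\<lambda>j. z $ j) * Qmat n"

(* singular values (with multiplicity): square roots of the eigenvalues of X^* X,
   i.e. of the roots of its characteristic polynomial (these eigenvalues are real >= 0) *)
definition singular_values :: "complex mat \<Rightarrow> real multiset" where
  "singular_values X = image_mset (\<lambda>e. sqrt (cmod e)) (proots (char_poly (mat_adjoint X * X)))"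

definition schatten_norm :: "real \<Rightarrow> complex mat \<Rightarrow> real" where
  "schatten_norm p X = (\<Sum>\<^sub># (image_mset (\<lambda>s. s powr p) (singular_values X))) powr (1 / p)"

end

theory Submission
  imports Defs
begin

text \<open>
  Let \<open>q\<^sub>j\<close> be the columns of \<open>Q\<close>, so \<open>T = T(z) = \<Sum>\<^sub>j z\<^sub>j q\<^sub>j q\<^sub>j\<^sup>*\<close>, and let \<open>\<sigma>\<^sub>a\<close> be the singular values
  of \<open>T\<close>. Write \<open>(\<Sum>\<sigma>\<^sub>a)\<^sup>2\<close> as \<open>\<Sum>\<sigma>\<^sub>a\<^sup>2\<close>, the squared Frobenius norm of \<open>T\<close>, plus twice
  \<open>\<Sum>\<^bsub>a<b\<^esub> \<sigma>\<^sub>a \<sigma>\<^sub>b\<close>, the trace norm of the second exterior power of \<open>T\<close>. Since \<open>\<Sum> z\<^sub>j = 0\<close>, the first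
  term equals \<open>(1 - 2/n) \<Sum>|z\<^sub>j|\<^sup>2\<close>. The exterior power is
  \<open>\<Sum>\<^bsub>i<j\<^esub> z\<^sub>i z\<^sub>j (q\<^sub>i \<and> q\<^sub>j) (q\<^sub>i \<and> q\<^sub>j)\<^sup>*\<close>, and the squared norm of \<open>q\<^sub>i \<and> q\<^sub>j\<close> is
  \<open>(1 - 1/n)\<^sup>2 - 1/n\<^sup>2 = 1 - 2/n\<close>, so by the triangle inequality its trace norm is at most
  \<open>(1 - 2/n) \<Sum>\<^bsub>i<j\<^esub> |z\<^sub>i| |z\<^sub>j|\<close>. Both terms together give \<open>(1 - 2/n) (\<Sum>|z\<^sub>j|)\<^sup>2\<close>.
\<close>

section \<open>Entries and adjoints of complex matrices\<close>

lemma mat_adjoint_carrier [simp]: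
  "A \<in> carrier_mat m n \<Longrightarrow> mat_adjoint A \<in> carrier_mat n m"
  by (auto simp: mat_adjoint_def)

lemma index_mat_adjoint:
  fixes A :: "complex mat"
  assumes "A \<in> carrier_mat m n" "i < n" "j < m"
  shows "mat_adjoint A $$ (i, j) = cnj (A $$ (j, i))"
  using assms by (auto simp: mat_adjoint_def mat_of_rows_def)

lemma index_mult_mat_sum:
  fixes A :: "complex mat"
  assumes "A \<in> carrier_mat m n" "B \<in> carrier_mat n k" "i < m" "j < k"
  shows "(A * B) $$ (i, j) = (\<Sum>l<n. A $$ (i, l) * B $$ (l, j))"
  using assms by (auto simp: scalar_prod_def atLeast0LessThan)

lemma mat_adjoint_mult:
  fixes A :: "complex mat"
  assumes A: "A \<in> carrier_mat m n" and B: "B \<in> carrier_mat n k"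
  shows "mat_adjoint (A * B) = mat_adjoint B * mat_adjoint A"
proof (rule eq_matI)
  fix i j assume "i < dim_row (mat_adjoint B * mat_adjoint A)" "j < dim_col (mat_adjoint B * mat_adjoint A)"
  then have i: "i < k" and j: "j < m" using A B by (auto simp: mat_adjoint_def)
  show "mat_adjoint (A * B) $$ (i, j) = (mat_adjoint B * mat_adjoint A) $$ (i, j)"
    using i j A B
    by (simp add: index_mat_adjoint[of _ m k] index_mult_mat_sum[of _ m n _ k]
        index_mult_mat_sum[of "mat_adjoint B" k n "mat_adjoint A" m]
        index_mat_adjoint[of _ m n] index_mat_adjoint[of _ n k] mult.commute
        del: index_mult_mat)
qed (use A B in \<open>auto simp: mat_adjoint_def\<close>)

lemma mat_adjoint_adjoint:
  fixes A :: "complex mat"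
  assumes A: "A \<in> carrier_mat m n"
  shows "mat_adjoint (mat_adjoint A) = A"
proof (rule eq_matI)
  show "dim_row (mat_adjoint (mat_adjoint A)) = dim_row A" "dim_col (mat_adjoint (mat_adjoint A)) = dim_col A"
    using A by (auto simp: mat_adjoint_def)
qed (use A in \<open>auto simp: index_mat_adjoint[of _ m n] index_mat_adjoint[of _ n m]\<close>)

section \<open>Unitary diagonalization of Hermitian matrices\<close>

text \<open>Gram-Schmidt on a basis that starts with \<open>v\<close> keeps \<open>v\<close> as
  first vector and gives orthogonal, not normalized, vectors. Dividing them by their lengths gives
  the columns of \<open>W\<close>. The scalar \<open>c\<close> stays unspecified, since any nonzero
  multiple of an eigenvector serves for the deflation below.\<close>

lemma unitary_first_column:
  fixes v :: "complex vec"
  assumes v: "v \<in> carrier_vec n" and v0: "v \<noteq> 0\<^sub>v n" 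
  obtains W c where "W \<in> carrier_mat n n" "mat_adjoint W * W = 1\<^sub>m n" "col W 0 = c \<cdot>\<^sub>v v"
proof -
  interpret cof_vec_space n "TYPE(complex)" .
  have n: "n \<noteq> 0" using v v0 by auto
  define b where "b = basis_completion v"
  define ws where "ws = gram_schmidt n b"
  note bc = basis_completion[OF v v0, folded b_def]
  have ws: "set ws \<subseteq> carrier_vec n" "corthogonal ws" "length ws = n"
    using gram_schmidt_result[OF bc(2,4,5) refl, folded ws_def] bc(6) by auto
  obtain vs where bv: "b = v # vs" using bc(6,7) n by (cases b) auto
  have "hd ws = v" using gram_schmidt_hd[OF v, of vs, folded bv] unfolding ws_def .
  then have ws0: "ws ! 0 = v" using ws(3) n by (metis hd_conv_nth list.size(3))
  have wc: "ws ! i \<in> carrier_vec n" if "i < n" for i using ws that by auto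
  define N where "N i = (\<Sum>l<n. (cmod (ws ! i $ l))\<^sup>2)" for i
  have ip: "ws ! i \<bullet>c ws ! j = (\<Sum>l<n. ws ! i $ l * cnj (ws ! j $ l))" if "i < n" "j < n" for i j
    using wc[OF that(1)] wc[OF that(2)] by (auto simp: scalar_prod_def atLeast0LessThan)
  have self: "ws ! i \<bullet>c ws ! i = of_real (N i)" if "i < n" for i
    unfolding ip[OF that that] N_def by (simp only: complex_norm_square of_real_sum)
  have Npos: "N i > 0" if "i < n" for i
  proof -
    have "of_real (N i) \<noteq> (0 :: complex)"
      unfolding self[OF that, symmetric] using corthogonalD[OF ws(2)] that ws(3) by auto
    moreover have "N i \<ge> 0" by (auto simp: N_def intro!: sum_nonneg)
    ultimately show ?thesis by simp
  qed
  define W where "W = Matrix.mat n n (\<lambda>(l, i). ws ! i $ l / of_real (sqrt (N i)))"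
  have W: "W \<in> carrier_mat n n" by (simp add: W_def)
  have "mat_adjoint W * W = 1\<^sub>m n"
  proof (rule eq_matI)
    fix i j assume "i < dim_row (1\<^sub>m n :: complex mat)" "j < dim_col (1\<^sub>m n :: complex mat)"
    then have i: "i < n" and j: "j < n" by auto
    \<comment> \<open>The conjugated factor comes from column \<open>i\<close>, while the product
      \<open>\<bullet>c\<close> conjugates its second argument; hence the order \<open>j\<close>,
      \<open>i\<close>.\<close>
    have "(mat_adjoint W * W) $$ (i, j)
        = (\<Sum>l<n. ws ! j $ l * cnj (ws ! i $ l) / (of_real (sqrt (N i)) * of_real (sqrt (N j))))"
      using i j W by (simp add: index_mult_mat_sum[of _ n n _ n] index_mat_adjoint[of _ n n] W_def
          mult.commute del: index_mult_mat)
    also have "\<dots> = (ws ! j \<bullet>c ws ! i) / (of_real (sqrt (N i)) * of_real (sqrt (N j)))"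
      unfolding ip[OF j i] by (simp add: sum_divide_distrib)
    also have "\<dots> = 1\<^sub>m n $$ (i, j)"
    proof (cases "i = j")
      case True
      have "of_real (sqrt (N j)) * of_real (sqrt (N j)) = (of_real (N j) :: complex)"
        using Npos[OF j] by (simp flip: of_real_mult)
      then show ?thesis using True i j Npos[OF j] self[OF j] by simp
    next
      case False
      then show ?thesis using i j corthogonalD[OF ws(2)] ws(3) by auto
    qed
    finally show "(mat_adjoint W * W) $$ (i, j) = 1\<^sub>m n $$ (i, j)" .
  qed (use W in \<open>auto simp: mat_adjoint_def\<close>)
  moreover have "col W 0 = (1 / of_real (sqrt (N 0))) \<cdot>\<^sub>v v"
    by (rule eq_vecI) (use W v n ws0 in \<open>auto simp: W_def\<close>)
  ultimately show ?thesis using W that by blast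
qed

text \<open>Induction by deflation. Conjugating with a unitary \<open>W\<close> whose first column
  is an eigenvector clears the first column below the diagonal; being Hermitian, the result also has
  a cleared first row. What is left is a Hermitian block \<open>C\<close> of size one less. The
  diagonal \<open>d\<close> is complex here; in the application to \<open>mat_adjoint X * X\<close>
  its entries are recognized as squared lengths.\<close>

lemma hermitian_diagonalization:
  fixes A :: "complex mat"
  assumes "A \<in> carrier_mat n n" "mat_adjoint A = A"
  shows "\<exists>V \<in> carrier_mat n n. \<exists>d. mat_adjoint V * V = 1\<^sub>m n \<and> mat_adjoint V * A * V = mat_diag n d"
  using assms
proof (induction n arbitrary: A)
  case 0
  then show ?case by (intro bexI[of _ "1\<^sub>m 0"] exI[of _ "\<lambda>_. 0"]) (auto simp: mat_adjoint_def mat_diag_def)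
next
  case (Suc m)
  let ?n = "Suc m"
  note A = Suc.prems(1)
  obtain e es where "char_poly A = (\<Prod>a \<leftarrow> e # es. [:- a, 1:])"
    using char_poly_factorized[OF A] by (metis length_Suc_conv)
  then have "eigenvalue A e" by (simp add: eigenvalue_root_char_poly[OF A])
  then obtain v where v: "v \<in> carrier_vec ?n" "v \<noteq> 0\<^sub>v ?n" "A *\<^sub>v v = e \<cdot>\<^sub>v v"
    using A unfolding eigenvalue_def eigenvector_def by auto
  obtain W c where W: "W \<in> carrier_mat ?n ?n" "mat_adjoint W * W = 1\<^sub>m ?n" "col W 0 = c \<cdot>\<^sub>v v"
    using unitary_first_column[OF v(1,2)] by blast
  define W' where "W' = mat_adjoint W"
  have W': "W' \<in> carrier_mat ?n ?n" using W by (simp add: W'_def)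
  define B where "B = W' * A * W"
  have B: "B \<in> carrier_mat ?n ?n" using W W' A by (simp add: B_def)
  have adjW': "mat_adjoint W' = W" using mat_adjoint_adjoint[OF W(1)] by (simp add: W'_def)
  have Bherm: "mat_adjoint B = B"
    unfolding B_def using W(1) W' A Suc.prems(2)
    by (simp add: mat_adjoint_mult[of _ ?n ?n _ ?n] adjW' W'_def[symmetric]
        assoc_mult_mat[of _ ?n ?n _ ?n _ ?n])
  \<comment> \<open>With w the first column of \<open>W\<close>, A w = e w gives W'(A w) = e (W' w),
    and W' w is the first column of W' W, the identity.\<close>
  have col0: "col B 0 = e \<cdot>\<^sub>v unit_vec ?n 0"
  proof -
    have "col B 0 = (W' * A) *\<^sub>v col W 0"
      unfolding B_def using W(1) W' A by (intro col_mult2[of _ ?n ?n _ ?n]) auto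
    also have "\<dots> = W' *\<^sub>v (A *\<^sub>v col W 0)" using W W' A v(1) by (intro assoc_mult_mat_vec) auto
    also have "A *\<^sub>v col W 0 = e \<cdot>\<^sub>v col W 0"
      using v A by (simp add: W(3) mult_mat_vec[of _ ?n ?n] smult_smult_assoc mult.commute)
    also have "W' *\<^sub>v (e \<cdot>\<^sub>v col W 0) = e \<cdot>\<^sub>v (W' *\<^sub>v col W 0)"
      using W W' v(1) by (intro mult_mat_vec) auto
    also have "W' *\<^sub>v col W 0 = col (W' * W) 0"
      using W(1) W' by (intro col_mult2[of _ ?n ?n _ ?n, symmetric]) auto
    finally show ?thesis by (simp add: W'_def W(2))
  qed
  have Bi0: "B $$ (Suc i, 0) = 0" if "i < m" for i
    using arg_cong[OF col0, of "\<lambda>v. v $ Suc i"] B that by simp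
  have B0i: "B $$ (0, Suc i) = 0" if "i < m" for i
    using Bi0[OF that] index_mat_adjoint[OF B, of 0 "Suc i"] that by (simp add: Bherm)
  define C where "C = Matrix.mat m m (\<lambda>(i, j). B $$ (Suc i, Suc j))"
  have C: "C \<in> carrier_mat m m" by (simp add: C_def)
  have "mat_adjoint C = C"
  proof (rule eq_matI)
    fix i j assume "i < dim_row C" "j < dim_col C"
    then have "i < m" "j < m" by (auto simp: C_def)
    then show "mat_adjoint C $$ (i, j) = C $$ (i, j)"
      using index_mat_adjoint[OF B, of "Suc i" "Suc j"]
      by (simp add: index_mat_adjoint[OF C] Bherm) (simp add: C_def)
  qed (use C in \<open>auto simp: mat_adjoint_def\<close>)
  from Suc.IH[OF C this] obtain U d where U: "U \<in> carrier_mat m m"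
    "mat_adjoint U * U = 1\<^sub>m m" "mat_adjoint U * C * U = mat_diag m d" by blast
  \<comment> \<open>The direct sum of the scalar \<open>a\<close> and the block \<open>X\<close>.
    Products and adjoints act blockwise on it, so \<open>F 1 U\<close> is unitary and extends the
    diagonalization of \<open>C\<close> to one of \<open>B\<close>.\<close>
  define F where "F a X = four_block_mat (Matrix.mat 1 1 (\<lambda>_. a)) (0\<^sub>m 1 m) (0\<^sub>m m 1) X"
    for a and X :: "complex mat"
  have F: "F a X \<in> carrier_mat ?n ?n" if "X \<in> carrier_mat m m" for a X
    using that by (auto simp: F_def)
  have F_index: "F a X $$ (i, j)
      = (if i = 0 \<and> j = 0 then a else if i = 0 \<or> j = 0 then 0 else X $$ (i - 1, j - 1))"
    if "X \<in> carrier_mat m m" "i < ?n" "j < ?n" for a X i j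
    using that by (auto simp: F_def)
  have F_mult: "F a X * F b Y = F (a * b) (X * Y)"
    if X: "X \<in> carrier_mat m m" and Y: "Y \<in> carrier_mat m m" for a b X Y
  proof -
    have XY: "X * Y \<in> carrier_mat m m" using X Y by simp
    show ?thesis
    proof (rule eq_matI)
      fix i j assume "i < dim_row (F (a * b) (X * Y))" "j < dim_col (F (a * b) (X * Y))"
      then have ij: "i < ?n" "j < ?n" using F[OF XY, of "a * b"] by auto
      then show "(F a X * F b Y) $$ (i, j) = F (a * b) (X * Y) $$ (i, j)"
        unfolding index_mult_mat_sum[OF F[OF X] F[OF Y] ij] sum.lessThan_Suc_shift
        by (auto simp: F_index X Y XY index_mult_mat_sum[OF X Y] simp del: index_mult_mat)
    qed (use F[OF X, of a] F[OF Y, of b] F[OF XY, of "a * b"] in auto)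
  qed
  have adjF: "mat_adjoint (F 1 U) = F 1 (mat_adjoint U)"
  proof (rule eq_matI)
    fix i j assume "i < dim_row (F 1 (mat_adjoint U))" "j < dim_col (F 1 (mat_adjoint U))"
    then have ij: "i < ?n" "j < ?n" using U by (auto simp: F_def mat_adjoint_def)
    have "mat_adjoint U \<in> carrier_mat m m" using U by simp
    then show "mat_adjoint (F 1 U) $$ (i, j) = F 1 (mat_adjoint U) $$ (i, j)"
      using ij U(1) by (auto simp: index_mat_adjoint[OF F[OF U(1)] ij] F_index index_mat_adjoint[OF U(1)])
  qed (use U in \<open>auto simp: F_def mat_adjoint_def\<close>)
  have B_block: "B = F e C"
  proof (rule eq_matI)
    fix i j assume "i < dim_row (F e C)" "j < dim_col (F e C)"
    then have ij: "i < ?n" "j < ?n" using F[OF C, of e] by auto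
    have "B $$ (0, 0) = e" using arg_cong[OF col0, of "\<lambda>v. v $ 0"] B by simp
    then show "B $$ (i, j) = F e C $$ (i, j)"
      using ij Bi0[of "i - 1"] B0i[of "j - 1"]
      by (cases i; cases j; simp add: F_index[OF C]; simp add: C_def)
  qed (use B F[OF C, of e] in auto)
  define V where "V = W * F 1 U"
  have V: "V \<in> carrier_mat ?n ?n" using W(1) F[OF U(1)] by (simp add: V_def)
  have U': "mat_adjoint U \<in> carrier_mat m m" using U by simp
  have adjV: "mat_adjoint V = F 1 (mat_adjoint U) * W'"
    unfolding V_def using mat_adjoint_mult[OF W(1) F[OF U(1)]] by (simp add: adjF W'_def)
  have "mat_adjoint V * V = F 1 (mat_adjoint U) * (W' * W) * F 1 U"
    unfolding adjV unfolding V_def using W(1) W' F[OF U(1)] F[OF U']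
    by (simp add: assoc_mult_mat[of _ ?n ?n _ ?n _ ?n])
  also have "\<dots> = F 1 (1\<^sub>m m)"
    by (simp add: W'_def W(2) right_mult_one_mat[OF F[OF U']] F_mult[OF U' U(1)] U(2))
  also have "\<dots> = 1\<^sub>m ?n"
    using F[of "1\<^sub>m m" 1] by (intro eq_matI) (auto simp: F_index)
  finally have 1: "mat_adjoint V * V = 1\<^sub>m ?n" .
  have "mat_adjoint V * A * V = F 1 (mat_adjoint U) * B * F 1 U"
    unfolding adjV unfolding V_def B_def using W(1) W' A F[OF U(1)] F[OF U']
    by (simp add: assoc_mult_mat[of _ ?n ?n _ ?n _ ?n])
  also have "\<dots> = F e (mat_diag m d)"
    by (simp add: B_block F_mult[OF U' C] F_mult[OF mult_carrier_mat[OF U' C] U(1)] U(3))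
  also have "\<dots> = mat_diag ?n (case_nat e d)"
  proof (rule eq_matI)
    fix i j assume "i < dim_row (mat_diag ?n (case_nat e d))" "j < dim_col (mat_diag ?n (case_nat e d))"
    then show "F e (mat_diag m d) $$ (i, j) = mat_diag ?n (case_nat e d) $$ (i, j)"
      by (cases i; cases j) (auto simp: F_index mat_diag_def)
  qed (use F[of "mat_diag m d" e] in \<open>auto simp: mat_diag_def\<close>)
  finally have "mat_adjoint V * A * V = mat_diag ?n (case_nat e d)" .
  with 1 V show ?case by (intro bexI[of _ V] exI[of _ "case_nat e d"] conjI)
qed

section \<open>Bessel's inequality for vectors and for 2 by 2 minors\<close>

text \<open>Expand the nonnegative squared norm of x - g, where g is the sum of the vectors
  \<open>f a\<close> weighted by the coefficients of \<open>x\<close>. The predicate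
  \<open>P\<close> lets some vectors of the orthonormal family be zero, as happens for left singular
  vectors at singular value 0.\<close>

lemma bessel_inequality:
  fixes f :: "'a \<Rightarrow> 'k \<Rightarrow> complex" and x :: "'k \<Rightarrow> complex"
  assumes fin: "finite I" "finite K"
    and orth: "\<And>a b. a \<in> I \<Longrightarrow> b \<in> I \<Longrightarrow>
      (\<Sum>k\<in>K. cnj (f a k) * f b k) = (if a = b then of_bool (P a) else 0)"
  shows "(\<Sum>a\<in>I. (cmod (\<Sum>k\<in>K. cnj (f a k) * x k))\<^sup>2) \<le> (\<Sum>k\<in>K. (cmod (x k))\<^sup>2)"
proof -
  define c where "c a = (\<Sum>k\<in>K. cnj (f a k) * x k)" for a
  define g where "g k = (\<Sum>a\<in>I. c a * f a k)" for k
  define S where "S = (\<Sum>a\<in>I. (cmod (c a))\<^sup>2)"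
  define X where "X = (\<Sum>k\<in>K. (cmod (x k))\<^sup>2)"
  have gx: "(\<Sum>k\<in>K. cnj (g k) * x k) = of_real S"
  proof -
    have "(\<Sum>k\<in>K. cnj (g k) * x k) = (\<Sum>k\<in>K. \<Sum>a\<in>I. cnj (c a) * (cnj (f a k) * x k))"
      by (simp add: g_def sum_distrib_right mult.assoc)
    also have "\<dots> = (\<Sum>a\<in>I. cnj (c a) * c a)"
      by (subst sum.swap) (simp add: c_def sum_distrib_left)
    also have "\<dots> = of_real S"
      unfolding S_def of_real_sum complex_norm_square by (simp add: mult.commute)
    finally show ?thesis .
  qed
  have gg: "(\<Sum>k\<in>K. cnj (g k) * g k) = of_real (\<Sum>a\<in>I. (cmod (c a))\<^sup>2 * of_bool (P a))"
  proof -
    have "(\<Sum>k\<in>K. cnj (g k) * g k)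
        = (\<Sum>k\<in>K. \<Sum>a\<in>I. \<Sum>b\<in>I. cnj (c a) * c b * (cnj (f a k) * f b k))"
      unfolding g_def cnj_sum sum_product by (simp add: mult_ac)
    also have "\<dots> = (\<Sum>a\<in>I. \<Sum>b\<in>I. cnj (c a) * c b * (\<Sum>k\<in>K. cnj (f a k) * f b k))"
      by (subst sum.swap, rule sum.cong[OF refl], subst sum.swap) (simp add: sum_distrib_left)
    also have "\<dots> = (\<Sum>a\<in>I. \<Sum>b\<in>I. if a = b then cnj (c a) * c b * of_bool (P a) else 0)"
      by (intro sum.cong refl) (simp add: orth)
    also have "\<dots> = (\<Sum>a\<in>I. cnj (c a) * c a * of_bool (P a))"
      using fin by simp
    also have "\<dots> = of_real (\<Sum>a\<in>I. (cmod (c a))\<^sup>2 * of_bool (P a))"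
      unfolding of_real_sum of_real_mult complex_norm_square by (intro sum.cong refl) simp
    finally show ?thesis .
  qed
  have "of_real (\<Sum>k\<in>K. (cmod (x k - g k))\<^sup>2)
      = (\<Sum>k\<in>K. x k * cnj (x k)) - (\<Sum>k\<in>K. cnj (g k) * x k)
        - cnj (\<Sum>k\<in>K. cnj (g k) * x k) + (\<Sum>k\<in>K. cnj (g k) * g k)"
    unfolding of_real_sum complex_norm_square
    by (simp add: algebra_simps sum.distrib sum_subtractf)
  also have "\<dots> = of_real (X - 2 * S + (\<Sum>a\<in>I. (cmod (c a))\<^sup>2 * of_bool (P a)))"
    unfolding gx gg by (simp add: X_def flip: complex_norm_square)
  finally have "(\<Sum>k\<in>K. (cmod (x k - g k))\<^sup>2)
      = X - 2 * S + (\<Sum>a\<in>I. (cmod (c a))\<^sup>2 * of_bool (P a))"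
    using of_real_eq_iff by blast
  moreover have "(\<Sum>k\<in>K. (cmod (x k - g k))\<^sup>2) \<ge> 0" by (simp add: sum_nonneg)
  \<comment> \<open>Bounding the indicator by 1 turns the expansion into 0 \<le> X - 2 S +
    S.\<close>
  moreover have "(\<Sum>a\<in>I. (cmod (c a))\<^sup>2 * of_bool (P a)) \<le> S"
    unfolding S_def by (intro sum_mono) simp
  ultimately show ?thesis by (simp add: S_def X_def c_def)
qed

text \<open>Bessel's inequality for \<open>x \<otimes> y - y \<otimes> x\<close> and the orthonormal tensors \<open>u a \<otimes> u b\<close>.\<close>
lemma bessel_minors:
  fixes u :: "'a \<Rightarrow> 'k \<Rightarrow> complex" and x y :: "'k \<Rightarrow> complex"
  assumes fin: "finite I" "finite K"
    and orth: "\<And>a b. a \<in> I \<Longrightarrow> b \<in> I \<Longrightarrow>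
      (\<Sum>k\<in>K. cnj (u a k) * u b k) = (if a = b then of_bool (P a) else 0)"
  defines "c a v \<equiv> \<Sum>k\<in>K. cnj (u a k) * v k"
  shows "(\<Sum>(a, b)\<in>I \<times> I. (cmod (c a x * c b y - c a y * c b x))\<^sup>2)
     \<le> 2 * ((\<Sum>k\<in>K. (cmod (x k))\<^sup>2) * (\<Sum>k\<in>K. (cmod (y k))\<^sup>2)
             - (cmod (\<Sum>k\<in>K. cnj (x k) * y k))\<^sup>2)"
proof -
  define f where "f = (\<lambda>(a, b) (k, l). u a k * u b l)"
  define w where "w = (\<lambda>(k, l). x k * y l - y k * x l)"
  \<comment> \<open>Inner products of tensors factor, so \<open>f (a, b)\<close> is nonzero exactly
    when both \<open>P a\<close> and \<open>P b\<close> hold.\<close>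
  have f: "(\<Sum>r\<in>K \<times> K. cnj (f p r) * f q r)
      = (if p = q then of_bool (case p of (a, b) \<Rightarrow> P a \<and> P b) else 0)"
    if "p \<in> I \<times> I" "q \<in> I \<times> I" for p q
  proof -
    obtain a b a' b' where pq: "p = (a, b)" "q = (a', b')" by (cases p; cases q)
    have "(\<Sum>r\<in>K \<times> K. cnj (f p r) * f q r)
        = (\<Sum>k\<in>K. cnj (u a k) * u a' k) * (\<Sum>l\<in>K. cnj (u b l) * u b' l)"
      by (simp add: sum_product sum.cartesian_product f_def pq mult_ac split_beta)
    then show ?thesis using that by (simp add: orth pq)
  qed
  have coef: "(\<Sum>r\<in>K \<times> K. cnj (f (a, b) r) * w r) = c a x * c b y - c a y * c b x" for a b
    unfolding c_def sum_product sum.cartesian_product sum_subtractf[symmetric]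
    by (intro sum.cong refl) (auto simp: f_def w_def algebra_simps)
  have "(\<Sum>p\<in>I \<times> I. (cmod (\<Sum>r\<in>K \<times> K. cnj (f p r) * w r))\<^sup>2) \<le> (\<Sum>r\<in>K \<times> K. (cmod (w r))\<^sup>2)"
    by (rule bessel_inequality) (use fin f in auto)
  also have "(\<Sum>p\<in>I \<times> I. (cmod (\<Sum>r\<in>K \<times> K. cnj (f p r) * w r))\<^sup>2)
      = (\<Sum>(a, b)\<in>I \<times> I. (cmod (c a x * c b y - c a y * c b x))\<^sup>2)"
    by (intro sum.cong refl) (auto simp: coef)
  \<comment> \<open>Lagrange's identity: the squared norm of the antisymmetric tensor is twice the
    Gram determinant of \<open>x\<close> and \<open>y\<close>.\<close>
  also have "(\<Sum>r\<in>K \<times> K. (cmod (w r))\<^sup>2)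
      = 2 * ((\<Sum>k\<in>K. (cmod (x k))\<^sup>2) * (\<Sum>k\<in>K. (cmod (y k))\<^sup>2)
             - (cmod (\<Sum>k\<in>K. cnj (x k) * y k))\<^sup>2)"
  proof -
    have "complex_of_real (\<Sum>r\<in>K \<times> K. (cmod (w r))\<^sup>2) = (\<Sum>r\<in>K \<times> K. w r * cnj (w r))"
      unfolding of_real_sum complex_norm_square ..
    also have "\<dots> = (\<Sum>k\<in>K. \<Sum>l\<in>K.
        (x k * cnj (x k)) * (y l * cnj (y l)) + (y k * cnj (y k)) * (x l * cnj (x l))
        - (cnj (y k) * x k) * (cnj (x l) * y l) - (cnj (x k) * y k) * (cnj (y l) * x l))"
      unfolding sum.cartesian_product by (intro sum.cong refl) (auto simp: w_def algebra_simps)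
    also have "\<dots> = 2 * ((\<Sum>k\<in>K. x k * cnj (x k)) * (\<Sum>k\<in>K. y k * cnj (y k))
         - (\<Sum>k\<in>K. cnj (x k) * y k) * cnj (\<Sum>k\<in>K. cnj (x k) * y k))"
      unfolding sum_subtractf sum.distrib sum_product[symmetric] by (simp add: algebra_simps)
    also have "\<dots> = of_real (2 * ((\<Sum>k\<in>K. (cmod (x k))\<^sup>2) * (\<Sum>k\<in>K. (cmod (y k))\<^sup>2)
             - (cmod (\<Sum>k\<in>K. cnj (x k) * y k))\<^sup>2))"
      unfolding of_real_mult of_real_diff of_real_sum complex_norm_square by simp
    finally show ?thesis using of_real_eq_iff by blast
  qed
  finally show ?thesis .
qed

section \<open>Trace norm bound through the second exterior power\<close>

text \<open>The triangle inequality for the trace norm of the second exterior power, in coordinates.\<close>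
lemma diagonal_sum_bound:
  fixes \<alpha> \<beta> :: "'a \<Rightarrow> 'j \<Rightarrow> complex" and z :: "'j \<Rightarrow> complex" and \<sigma> :: "'a \<Rightarrow> real"
  assumes fin: "finite I" "finite J"
    and diag: "\<And>a b. a \<in> I \<Longrightarrow> b \<in> I \<Longrightarrow>
      (\<Sum>j\<in>J. z j * \<alpha> a j * \<beta> b j) = (if a = b then of_real (\<sigma> a) else 0)"
    and \<alpha>: "\<And>i j. i \<in> J \<Longrightarrow> j \<in> J \<Longrightarrow> i \<noteq> j \<Longrightarrow>
      (\<Sum>(a, b)\<in>I \<times> I. (cmod (\<alpha> a i * \<alpha> b j - \<alpha> a j * \<alpha> b i))\<^sup>2) \<le> 2 * k"
    and \<beta>: "\<And>i j. i \<in> J \<Longrightarrow> j \<in> J \<Longrightarrow> i \<noteq> j \<Longrightarrow>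
      (\<Sum>(a, b)\<in>I \<times> I. (cmod (\<beta> a i * \<beta> b j - \<beta> a j * \<beta> b i))\<^sup>2) \<le> 2 * k"
  shows "(\<Sum>a\<in>I. \<sigma> a)\<^sup>2 - (\<Sum>a\<in>I. (\<sigma> a)\<^sup>2)
      \<le> k * ((\<Sum>j\<in>J. cmod (z j))\<^sup>2 - (\<Sum>j\<in>J. (cmod (z j))\<^sup>2))"
proof -
  define M where "M a b = (\<Sum>j\<in>J. z j * \<alpha> a j * \<beta> b j)" for a b
  define A where "A i j p = (case p of (a, b) \<Rightarrow> \<alpha> a i * \<alpha> b j - \<alpha> a j * \<alpha> b i)" for i j p
  define B where "B i j p = (case p of (a, b) \<Rightarrow> \<beta> a i * \<beta> b j - \<beta> a j * \<beta> b i)" for i j p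
  \<comment> \<open>the Cauchy-Binet formula for 2 by 2 minors, summed over ordered instead of unordered pairs\<close>
  have cauchy_binet: "2 * (M a a * M b b - M a b * M b a)
      = (\<Sum>(i, j)\<in>J \<times> J. z i * z j * (A i j (a, b) * B i j (a, b)))" for a b
  proof -
    have 1: "M a' b' * M c d = (\<Sum>(i, j)\<in>J \<times> J. z i * z j * (\<alpha> a' i * \<beta> b' i * \<alpha> c j * \<beta> d j))"
      for a' b' c d
      by (simp add: M_def sum_product sum.cartesian_product mult_ac)
    have "2 * (M a a * M b b - M a b * M b a)
        = M a a * M b b + M b b * M a a - M a b * M b a - M b a * M a b" by simp
    also have "\<dots> = (\<Sum>(i, j)\<in>J \<times> J. z i * z j * (A i j (a, b) * B i j (a, b)))"
      unfolding 1 sum.distrib[symmetric] sum_subtractf[symmetric]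
      by (intro sum.cong refl) (auto simp: A_def B_def algebra_simps)
    finally show ?thesis .
  qed
  \<comment> \<open>The type of the index is kept generic because this serves twice: for
    \<open>\<sigma>\<close> over \<open>I\<close> and for the moduli of \<open>z\<close> over
    \<open>J\<close>.\<close>
  have sq: "((\<Sum>a\<in>I. s a)\<^sup>2 - (\<Sum>a\<in>I. (s a)\<^sup>2))
      = (\<Sum>(a, b)\<in>I \<times> I. if a = b then 0 else s a * s b)" if "finite I"
    for s :: "'b \<Rightarrow> real" and I :: "'b set"
  proof -
    have "(\<Sum>a\<in>I. (s a)\<^sup>2) = (\<Sum>(a, b)\<in>I \<times> I. if a = b then s a * s b else 0)"
      unfolding sum.cartesian_product[symmetric] using that by (simp add: power2_eq_square)
    then show ?thesis
      by (simp add: power2_eq_square sum_product sum.cartesian_product sum_subtractf[symmetric])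
        (intro sum.cong refl, auto)
  qed
  \<comment> \<open>The arithmetic-geometric mean inequality replaces Cauchy-Schwarz. Nothing is
    lost, as both sums of squares have the same bound 2 k.\<close>
  have cs: "(\<Sum>p\<in>I \<times> I. cmod (A i j p) * cmod (B i j p)) \<le> 2 * k"
    if "i \<in> J" "j \<in> J" "i \<noteq> j" for i j
  proof -
    have "(\<Sum>p\<in>I \<times> I. cmod (A i j p) * cmod (B i j p))
        \<le> (\<Sum>p\<in>I \<times> I. ((cmod (A i j p))\<^sup>2 + (cmod (B i j p))\<^sup>2) / 2)"
    proof (rule sum_mono)
      fix p
      show "cmod (A i j p) * cmod (B i j p) \<le> ((cmod (A i j p))\<^sup>2 + (cmod (B i j p))\<^sup>2) / 2"
        using sum_squares_bound[of "cmod (A i j p)" "cmod (B i j p)"] by simp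
    qed
    also have "\<dots> = ((\<Sum>p\<in>I \<times> I. (cmod (A i j p))\<^sup>2) + (\<Sum>p\<in>I \<times> I. (cmod (B i j p))\<^sup>2)) / 2"
      by (simp add: sum_divide_distrib[symmetric] sum.distrib)
    also have "\<dots> \<le> 2 * k"
      using \<alpha>[OF that] \<beta>[OF that] by (simp add: A_def B_def split_beta)
    finally show ?thesis .
  qed
  \<comment> \<open>\<open>M\<close> is diagonal with entries \<open>\<sigma> a\<close>, so its
    principal minor for (a, b) is the product of \<open>\<sigma> a\<close> and
    \<open>\<sigma> b\<close> if a and b differ, and 0 otherwise.\<close>
  have "complex_of_real (2 * ((\<Sum>a\<in>I. \<sigma> a)\<^sup>2 - (\<Sum>a\<in>I. (\<sigma> a)\<^sup>2)))
      = (\<Sum>(a, b)\<in>I \<times> I. 2 * (M a a * M b b - M a b * M b a))"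
    unfolding sq[OF fin(1)] of_real_mult of_real_sum sum_distrib_left
    by (intro sum.cong refl) (auto simp: M_def diag)
  also have "\<dots> = (\<Sum>(i, j)\<in>J \<times> J. z i * z j * (\<Sum>p\<in>I \<times> I. A i j p * B i j p))"
    unfolding cauchy_binet split_beta prod.collapse
    by (subst sum.swap) (simp add: sum_distrib_left)
  finally have minors: "complex_of_real (2 * ((\<Sum>a\<in>I. \<sigma> a)\<^sup>2 - (\<Sum>a\<in>I. (\<sigma> a)\<^sup>2)))
      = (\<Sum>(i, j)\<in>J \<times> J. z i * z j * (\<Sum>p\<in>I \<times> I. A i j p * B i j p))" .
  have "2 * ((\<Sum>a\<in>I. \<sigma> a)\<^sup>2 - (\<Sum>a\<in>I. (\<sigma> a)\<^sup>2))
      \<le> cmod (complex_of_real (2 * ((\<Sum>a\<in>I. \<sigma> a)\<^sup>2 - (\<Sum>a\<in>I. (\<sigma> a)\<^sup>2))))"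
    unfolding norm_of_real by (rule abs_ge_self)
  also have "\<dots> = cmod (\<Sum>(i, j)\<in>J \<times> J. z i * z j * (\<Sum>p\<in>I \<times> I. A i j p * B i j p))"
    unfolding minors ..
  also have "\<dots> \<le> (\<Sum>(i, j)\<in>J \<times> J. if i = j then 0 else cmod (z i) * cmod (z j) * (2 * k))"
  proof (rule sum_norm_le, clarify)
    fix i j assume ij: "i \<in> J" "j \<in> J"
    have "cmod (\<Sum>p\<in>I \<times> I. A i j p * B i j p) \<le> (\<Sum>p\<in>I \<times> I. cmod (A i j p) * cmod (B i j p))"
      by (rule order_trans[OF norm_sum]) (simp add: norm_mult)
    \<comment> \<open>A minor with two equal columns vanishes. This is what leaves only the
      off-diagonal products of the moduli of \<open>z\<close>.\<close>
    also have "\<dots> \<le> (if i = j then 0 else 2 * k)"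
      using cs[OF ij] by (auto simp: A_def)
    finally have "cmod (z i) * cmod (z j) * cmod (\<Sum>p\<in>I \<times> I. A i j p * B i j p)
        \<le> cmod (z i) * cmod (z j) * (if i = j then 0 else 2 * k)"
      by (intro mult_left_mono) auto
    then show "cmod (z i * z j * (\<Sum>p\<in>I \<times> I. A i j p * B i j p))
        \<le> (if i = j then 0 else cmod (z i) * cmod (z j) * (2 * k))"
      by (simp add: norm_mult split: if_splits)
  qed
  also have "\<dots> = 2 * (k * ((\<Sum>j\<in>J. cmod (z j))\<^sup>2 - (\<Sum>j\<in>J. (cmod (z j))\<^sup>2)))"
    unfolding sq[OF fin(2)] sum_distrib_left
    by (intro sum.cong refl) auto
  finally show ?thesis by simp
qed

section \<open>Singular value decomposition and the trace norm\<close>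

text \<open>The right singular vectors \<open>v a\<close> are the columns of a unitary
  \<open>V\<close> diagonalizing \<open>mat_adjoint X * X\<close>. Their images \<open>y a\<close>
  under \<open>X\<close> are pairwise orthogonal, the lengths are the singular values, and the
  scaled images are the left singular vectors \<open>u a\<close>. The Frobenius bound is stated in
  the direction that Bessel's inequality yields.\<close>

lemma schatten_norm_1_svd:
  assumes X: "X \<in> carrier_mat n n"
  obtains \<sigma> :: "nat \<Rightarrow> real" and u v :: "nat \<Rightarrow> nat \<Rightarrow> complex" where
    "schatten_norm 1 X = (\<Sum>a<n. \<sigma> a)"
    "\<And>a b. a < n \<Longrightarrow> b < n \<Longrightarrow> (\<Sum>k<n. cnj (u a k) * u b k)
      = (if a = b then of_bool (\<sigma> a \<noteq> 0) else 0)"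
    "\<And>a b. a < n \<Longrightarrow> b < n \<Longrightarrow> (\<Sum>k<n. cnj (v a k) * v b k) = (if a = b then 1 else 0)"
    "\<And>a b. a < n \<Longrightarrow> b < n \<Longrightarrow> (\<Sum>i<n. \<Sum>j<n. cnj (u a i) * X $$ (i, j) * v b j)
      = (if a = b then of_real (\<sigma> a) else 0)"
    "(\<Sum>a<n. (\<sigma> a)\<^sup>2) \<le> (\<Sum>i<n. \<Sum>j<n. (cmod (X $$ (i, j)))\<^sup>2)"
proof -
  define H where "H = mat_adjoint X * X"
  have X': "mat_adjoint X \<in> carrier_mat n n" using X by simp
  have H: "H \<in> carrier_mat n n" using mult_carrier_mat[OF X' X] by (simp add: H_def)
  have "mat_adjoint H = H"
    using mat_adjoint_mult[OF X' X] mat_adjoint_adjoint[OF X] by (simp add: H_def)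
  then obtain V d where V: "V \<in> carrier_mat n n" and VV: "mat_adjoint V * V = 1\<^sub>m n"
    and VHV: "mat_adjoint V * H * V = mat_diag n d"
    using hermitian_diagonalization[OF H] by blast
  have V': "mat_adjoint V \<in> carrier_mat n n" using V by simp
  define v where "v a k = V $$ (k, a)" for a k
  define y where "y a i = (\<Sum>j<n. X $$ (i, j) * v a j)" for a i
  have XV: "(X * V) $$ (i, a) = y a i" if "i < n" "a < n" for i a
    using that by (simp add: index_mult_mat_sum[OF X V] y_def v_def del: index_mult_mat)
  have XVc: "X * V \<in> carrier_mat n n" using X V by simp
  have vv: "(\<Sum>k<n. cnj (v a k) * v b k) = (if a = b then 1 else 0)" if "a < n" "b < n" for a b
  proof -
    have "(\<Sum>k<n. cnj (v a k) * v b k) = (mat_adjoint V * V) $$ (a, b)"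
      using that by (simp add: index_mult_mat_sum[OF V' V] index_mat_adjoint[OF V] v_def del: index_mult_mat)
    then show ?thesis using that by (simp add: VV)
  qed
  have yy: "(\<Sum>i<n. cnj (y a i) * y b i) = (if a = b then d a else 0)" if "a < n" "b < n" for a b
  proof -
    have "(\<Sum>i<n. cnj (y a i) * y b i) = (mat_adjoint (X * V) * (X * V)) $$ (a, b)"
      using that by (simp add: index_mult_mat_sum[OF mat_adjoint_carrier[OF XVc] XVc]
          index_mat_adjoint[OF XVc] XV del: index_mult_mat)
    also have "mat_adjoint (X * V) * (X * V) = mat_adjoint V * H * V"
      by (simp only: mat_adjoint_mult[OF X V] assoc_mult_mat[OF V' X' XVc] H_def
          assoc_mult_mat[OF X' X V, symmetric] assoc_mult_mat[OF V' H[unfolded H_def] V])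
    finally show ?thesis using that by (simp add: VHV mat_diag_def)
  qed
  \<comment> \<open>Taking lengths of the images makes \<open>\<sigma>\<close> real and nonnegative
    at once; fact \<open>d\<close> then shows that the complex eigenvalues \<open>d a\<close> are
    the squares of these numbers.\<close>
  define \<sigma> where "\<sigma> a = sqrt (\<Sum>i<n. (cmod (y a i))\<^sup>2)" for a
  have \<sigma>2: "(\<sigma> a)\<^sup>2 = (\<Sum>i<n. (cmod (y a i))\<^sup>2)" and \<sigma>0: "\<sigma> a \<ge> 0" for a
    by (simp_all add: \<sigma>_def sum_nonneg)
  have d: "d a = of_real ((\<sigma> a)\<^sup>2)" if "a < n" for a
  proof -
    have "d a = (\<Sum>i<n. cnj (y a i) * y a i)" using yy[OF that that] by simp
    also have "\<dots> = of_real ((\<sigma> a)\<^sup>2)"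
      unfolding \<sigma>2 of_real_sum complex_norm_square by (simp add: mult.commute)
    finally show ?thesis .
  qed
  \<comment> \<open>Singular values are defined through roots of the characteristic polynomial.
    Similarity to a diagonal matrix identifies these roots, with multiplicity, as the entries of
    \<open>d\<close>.\<close>
  have "similar_mat (mat_diag n d) H"
    using mat_mult_left_right_inverse[OF V' V VV] V V' H VV VHV
    by (intro similar_matI[of _ _ "mat_adjoint V" V n]) auto
  then have "char_poly H = char_poly (mat_diag n d)" by (simp add: char_poly_similar)
  also have "\<dots> = (\<Prod>e \<leftarrow> map d [0..<n]. [:- e, 1:])"
    by (subst char_poly_upper_triangular[of _ n])
      (auto simp: mat_diag_def diag_mat_def intro!: arg_cong[of _ _ prod_list])
  finally have cp: "char_poly H = (\<Prod>e \<leftarrow> map d [0..<n]. [:- e, 1:])" .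
  have "proots (char_poly H) = mset (map d [0..<n])"
  proof -
    have "proots (\<Prod>e \<leftarrow> es. [:- e, 1:]) = mset es" for es :: "complex list"
    proof (induction es)
      case (Cons e es)
      have "(\<Prod>e \<leftarrow> es. [:- e, 1:]) \<noteq> (0 :: complex poly)"
        by (auto simp: prod_list_zero_iff)
      then show ?case using Cons by (simp add: proots_mult del: mult_pCons_left)
    qed simp
    then show ?thesis by (simp only: cp)
  qed
  then have "singular_values X = mset (map (\<lambda>a. sqrt (cmod (d a))) [0..<n])"
    by (simp add: singular_values_def H_def[symmetric] multiset.map_comp o_def)
  also have "map (\<lambda>a. sqrt (cmod (d a))) [0..<n] = map \<sigma> [0..<n]"
    using \<sigma>0 by (simp add: d norm_power)
  \<comment> \<open>The outer \<open>powr\<close> with exponent 1 is the absolute value, which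
    nonnegativity of \<open>\<sigma>\<close> removes next.\<close>
  finally have "schatten_norm 1 X = \<bar>sum_list (map (\<lambda>a. \<sigma> a powr 1) [0..<n])\<bar>"
    by (simp add: schatten_norm_def multiset.map_comp o_def flip: sum_mset_sum_list)
  then have norm: "schatten_norm 1 X = (\<Sum>a<n. \<sigma> a)"
    using \<sigma>0 by (simp add: interv_sum_list_conv_sum_set_nat atLeast0LessThan sum_nonneg)
  \<comment> \<open>Division by zero makes \<open>u a\<close> the zero vector when \<open>\<sigma> a = 0\<close>, so \<open>u\<close> need not be completed
    to an orthonormal basis.\<close>
  define u where "u a i = y a i / of_real (\<sigma> a)" for a i
  have uy: "(\<Sum>i<n. cnj (u a i) * y b i) = (if a = b then of_real (\<sigma> a) else 0)" if "a < n" "b < n" for a b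
  proof -
    have "(\<Sum>i<n. cnj (u a i) * y b i) = (\<Sum>i<n. cnj (y a i) * y b i) / of_real (\<sigma> a)"
      by (simp add: u_def sum_divide_distrib)
    then show ?thesis using that by (simp add: yy d power2_eq_square)
  qed
  have uu: "(\<Sum>i<n. cnj (u a i) * u b i) = (if a = b then of_bool (\<sigma> a \<noteq> 0) else 0)"
    if "a < n" "b < n" for a b
  proof -
    have "(\<Sum>i<n. cnj (u a i) * u b i) = (\<Sum>i<n. cnj (u a i) * y b i) / of_real (\<sigma> b)"
      by (simp add: u_def sum_divide_distrib)
    then show ?thesis using that by (simp add: uy)
  qed
  have "(\<Sum>a<n. (\<sigma> a)\<^sup>2) = (\<Sum>i<n. \<Sum>a<n. (cmod (y a i))\<^sup>2)"
    unfolding \<sigma>2 by (rule sum.swap)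
  also have "\<dots> \<le> (\<Sum>i<n. \<Sum>j<n. (cmod (X $$ (i, j)))\<^sup>2)"
  proof (rule sum_mono)
    fix i
    \<comment> \<open>Bessel's inequality for the conjugated row \<open>i\<close> of
      \<open>X\<close>, whose coefficients along the \<open>v a\<close> are the conjugates of
      \<open>y a i\<close>.\<close>
    have "(\<Sum>a<n. (cmod (\<Sum>j<n. cnj (v a j) * cnj (X $$ (i, j))))\<^sup>2)
        \<le> (\<Sum>j<n. (cmod (cnj (X $$ (i, j))))\<^sup>2)"
      by (rule bessel_inequality[where P = "\<lambda>_. True"]) (auto simp: vv)
    moreover have "(\<Sum>j<n. cnj (v a j) * cnj (X $$ (i, j))) = cnj (y a i)" for a
      by (simp add: y_def mult.commute)
    ultimately show "(\<Sum>a<n. (cmod (y a i))\<^sup>2) \<le> (\<Sum>j<n. (cmod (X $$ (i, j)))\<^sup>2)" by simp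
  qed
  finally have "(\<Sum>a<n. (\<sigma> a)\<^sup>2) \<le> (\<Sum>i<n. \<Sum>j<n. (cmod (X $$ (i, j)))\<^sup>2)" .
  moreover have "(\<Sum>i<n. \<Sum>j<n. cnj (u a i) * X $$ (i, j) * v b j)
      = (if a = b then of_real (\<sigma> a) else 0)"
    if "a < n" "b < n" for a b
    using uy[OF that] by (simp add: y_def sum_distrib_left mult.assoc)
  ultimately show ?thesis using that norm uu vv by blast
qed

section \<open>The matrices Q and T(z)\<close>

lemma Qmat_carrier: "Qmat n \<in> carrier_mat n n"
  by (auto simp: Qmat_def ones_mat_def)

lemma index_Qmat:
  "i < n \<Longrightarrow> j < n \<Longrightarrow> Qmat n $$ (i, j) = of_real (of_bool (i = j) - 1 / real n)"
  by (auto simp: Qmat_def ones_mat_def)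

lemma Tmat_carrier: "Tmat n z \<in> carrier_mat n n"
  unfolding Tmat_def by (intro mult_carrier_mat[of _ n n] Qmat_carrier mat_diag_dim)

lemma index_Tmat:
  assumes "i < n" "j < n"
  shows "Tmat n z $$ (i, j) = (\<Sum>l<n. Qmat n $$ (i, l) * z $ l * Qmat n $$ (l, j))"
  using assms Qmat_carrier[of n]
  by (simp add: Tmat_def mat_diag_mult_right[OF Qmat_carrier] index_mult_mat_sum[of _ n n _ n]
      del: index_mult_mat)

text \<open>As the z_j sum to 0, the entry (i, j) of T(z) is [i = j] z_i - r (z_i + z_j) with r =
  1/n. In the squared moduli the mixed terms sum to 0 for the same reason. The rest contributes 1 -
  4 r from the diagonal and r twice, by n r = 1.\<close>

lemma Tmat_frobenius:
  assumes "n \<ge> 1" and z0: "(\<Sum>j<n. z $ j) = 0"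
  shows "(\<Sum>i<n. \<Sum>j<n. (cmod (Tmat n z $$ (i, j)))\<^sup>2) = (1 - 2 / real n) * (\<Sum>j<n. (cmod (z $ j))\<^sup>2)"
proof -
  define r where "r = 1 / complex_of_real (real n)"
  have rn: "of_nat n * r = 1" using assms by (simp add: r_def)
  have cnjr: "cnj r = r" by (simp add: r_def)
  have T: "Tmat n z $$ (i, j) = of_bool (i = j) * z $ i - r * (z $ i + z $ j)" if "i < n" "j < n" for i j
  proof -
    have "Tmat n z $$ (i, j) = (\<Sum>l<n. (of_bool (i = l) - r) * z $ l * (of_bool (l = j) - r))"
      unfolding index_Tmat[OF that] using that by (intro sum.cong refl) (simp add: index_Qmat r_def)
    also have "\<dots> = (\<Sum>l<n. (if i = l then of_bool (i = j) * z $ i - r * z $ i else 0)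
        - (if l = j then r * z $ j else 0) + r * r * z $ l)"
      by (intro sum.cong refl) (auto simp: algebra_simps)
    also have "\<dots> = of_bool (i = j) * z $ i - r * z $ i - r * z $ j + r * r * (\<Sum>l<n. z $ l)"
      using that by (simp add: sum.distrib sum_subtractf sum_distrib_left)
    finally show ?thesis using z0 by (simp add: algebra_simps)
  qed
  define S where "S = (\<Sum>j<n. z $ j * cnj (z $ j))"
  have cz0: "(\<Sum>j<n. cnj (z $ j)) = 0" using arg_cong[OF z0, of cnj] by simp
  have row: "(\<Sum>j<n. Tmat n z $$ (i, j) * cnj (Tmat n z $$ (i, j)))
      = (1 - 3 * r) * (z $ i * cnj (z $ i)) + r * r * S" if i: "i < n" for i
  proof -
    have "(\<Sum>j<n. Tmat n z $$ (i, j) * cnj (Tmat n z $$ (i, j)))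
      = (\<Sum>j<n. (if i = j then (1 - 4 * r) * (z $ i * cnj (z $ i)) else 0)
          + r * r * (z $ i * cnj (z $ i)) + r * r * z $ i * cnj (z $ j)
          + r * r * cnj (z $ i) * z $ j + r * r * (z $ j * cnj (z $ j)))"
      using i by (intro sum.cong refl) (auto simp: T cnjr algebra_simps)
    also have "\<dots> = (1 - 4 * r) * (z $ i * cnj (z $ i)) + (of_nat n * r) * r * (z $ i * cnj (z $ i))
          + r * r * z $ i * (\<Sum>j<n. cnj (z $ j)) + r * r * cnj (z $ i) * (\<Sum>j<n. z $ j) + r * r * S"
      using i by (simp add: sum.distrib sum_distrib_left S_def)
    finally show ?thesis unfolding rn cz0 z0 by (simp add: algebra_simps)
  qed
  have "complex_of_real (\<Sum>i<n. \<Sum>j<n. (cmod (Tmat n z $$ (i, j)))\<^sup>2)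
      = (\<Sum>i<n. (1 - 3 * r) * (z $ i * cnj (z $ i)) + r * r * S)"
    unfolding of_real_sum complex_norm_square by (intro sum.cong refl) (simp add: row)
  also have "\<dots> = (1 - 3 * r) * S + (of_nat n * r) * r * S"
    by (simp add: sum.distrib S_def sum_distrib_left mult.assoc)
  also have "\<dots> = (1 - 2 * r) * S" unfolding rn by (simp add: algebra_simps)
  also have "\<dots> = of_real ((1 - 2 / real n) * (\<Sum>j<n. (cmod (z $ j))\<^sup>2))"
    unfolding S_def of_real_mult of_real_sum complex_norm_square by (simp add: r_def)
  finally show ?thesis using of_real_eq_iff by blast
qed

text \<open>Q is a real symmetric projection, so the inner products of its columns are its own
  entries. The Gram determinant of two columns is therefore (1 - r)^2 - r^2 = 1 - 2 r with r =
  1/n.\<close>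

lemma Qmat_columns_gram:
  assumes "i < n" "j < n" "i \<noteq> j"
  shows "(\<Sum>k<n. (cmod (Qmat n $$ (k, i)))\<^sup>2) * (\<Sum>k<n. (cmod (Qmat n $$ (k, j)))\<^sup>2)
      - (cmod (\<Sum>k<n. cnj (Qmat n $$ (k, i)) * Qmat n $$ (k, j)))\<^sup>2 = 1 - 2 / real n"
proof -
  define r where "r = 1 / real n"
  have rn: "real n * r = 1" using assms by (simp add: r_def)
  have 0: "(\<Sum>k<n. (of_bool (k = a) - r) * (of_bool (k = b) - r)) = of_bool (a = b) - r"
    if "a < n" "b < n" for a b
  proof -
    have "(\<Sum>k<n. (of_bool (k = a) - r) * (of_bool (k = b) - r))
        = (\<Sum>k<n. (if k = a then of_bool (a = b) - r else 0) - (if k = b then r else 0) + r * r)"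
      by (intro sum.cong refl) (auto simp: algebra_simps)
    also have "\<dots> = of_bool (a = b) - r - r + (real n * r) * r"
      using that by (simp add: sum.distrib sum_subtractf)
    finally show ?thesis unfolding rn by simp
  qed
  have norm: "(\<Sum>k<n. (cmod (Qmat n $$ (k, a)))\<^sup>2) = 1 - r" if "a < n" for a
  proof -
    have "(\<Sum>k<n. (cmod (Qmat n $$ (k, a)))\<^sup>2) = (\<Sum>k<n. (of_bool (k = a) - r) * (of_bool (k = a) - r))"
      using that by (intro sum.cong refl)
        (simp add: index_Qmat r_def power2_eq_square del: of_real_diff)
    then show ?thesis using 0[OF that that] by simp
  qed
  have "(\<Sum>k<n. cnj (Qmat n $$ (k, i)) * Qmat n $$ (k, j))
      = of_real (\<Sum>k<n. (of_bool (k = i) - r) * (of_bool (k = j) - r))"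
    unfolding of_real_sum using assms by (intro sum.cong refl) (simp add: index_Qmat r_def)
  also have "\<dots> = of_real (- r)" using 0[OF assms(1,2)] assms(3) by simp
  finally have "cmod (\<Sum>k<n. cnj (Qmat n $$ (k, i)) * Qmat n $$ (k, j)) = \<bar>r\<bar>"
    by (simp only: norm_of_real abs_minus_cancel)
  then show ?thesis
    unfolding norm[OF assms(1)] norm[OF assms(2)]
    by (simp add: power2_eq_square algebra_simps) (simp add: r_def)
qed

section \<open>The trace norm bound for T(z)\<close>

theorem theorem4p1:
  fixes n :: nat and z :: "complex vec"
  assumes "n \<ge> 2"
    and "z \<in> carrier_vec n"
    and "(\<Sum>j<n. z $ j) = 0"
  shows "schatten_norm 1 (Tmat n z) \<le> sqrt ((real n - 2) / real n) * (\<Sum>j<n. cmod (z $ j))"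
proof -
  let ?Q = "\<lambda>i j. Qmat n $$ (i, j)"
  define k where "k = 1 - 2 / real n"
  obtain \<sigma> u v where
    norm: "schatten_norm 1 (Tmat n z) = (\<Sum>a<n. \<sigma> a)"
    and u: "\<And>a b. a < n \<Longrightarrow> b < n \<Longrightarrow> (\<Sum>k<n. cnj (u a k) * u b k)
      = (if a = b then of_bool (\<sigma> a \<noteq> 0) else 0)"
    and v: "\<And>a b. a < n \<Longrightarrow> b < n \<Longrightarrow> (\<Sum>k<n. cnj (v a k) * v b k) = (if a = b then 1 else 0)"
    and uv: "\<And>a b. a < n \<Longrightarrow> b < n \<Longrightarrow>
      (\<Sum>i<n. \<Sum>j<n. cnj (u a i) * Tmat n z $$ (i, j) * v b j)
      = (if a = b then of_real (\<sigma> a) else 0)"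
    and sq: "(\<Sum>a<n. (\<sigma> a)\<^sup>2) \<le> (\<Sum>i<n. \<Sum>j<n. (cmod (Tmat n z $$ (i, j)))\<^sup>2)"
    by (rule schatten_norm_1_svd[OF Tmat_carrier[of n z]]) (rule that)
  \<comment> \<open>Coordinates of the columns of Q along the singular vectors. The double
    conjugation in \<open>\<beta>\<close> gives it the shape of the coefficients in
    \<open>bessel_minors\<close>, for the family of conjugated \<open>v b\<close>.\<close>
  define \<alpha> where "\<alpha> a j = (\<Sum>i<n. cnj (u a i) * ?Q i j)" for a j
  define \<beta> where "\<beta> b j = (\<Sum>i<n. cnj (cnj (v b i)) * ?Q i j)" for b j
  have Q_sym: "?Q i j = ?Q j i" if "i < n" "j < n" for i j
    using that by (auto simp: index_Qmat)
  have "(\<Sum>a<n. \<sigma> a)\<^sup>2 - (\<Sum>a<n. (\<sigma> a)\<^sup>2)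
      \<le> k * ((\<Sum>j<n. cmod (z $ j))\<^sup>2 - (\<Sum>j<n. (cmod (z $ j))\<^sup>2))"
  proof (rule diagonal_sum_bound[where \<alpha> = \<alpha> and \<beta> = \<beta>])
    fix a b assume ab: "a \<in> {..<n}" "b \<in> {..<n}"
    have "(\<Sum>j<n. z $ j * \<alpha> a j * \<beta> b j)
        = (\<Sum>j<n. \<Sum>i<n. \<Sum>l<n. cnj (u a i) * (?Q i j * z $ j * ?Q j l) * v b l)"
    proof (rule sum.cong[OF refl])
      fix j assume "j \<in> {..<n}"
      then have "z $ j * (\<alpha> a j * \<beta> b j)
          = (\<Sum>i<n. \<Sum>l<n. cnj (u a i) * (?Q i j * z $ j * ?Q j l) * v b l)"
        unfolding \<alpha>_def \<beta>_def sum_product unfolding sum_distrib_left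
        by (intro sum.cong refl) (simp add: Q_sym[of j])
      then show "z $ j * \<alpha> a j * \<beta> b j
          = (\<Sum>i<n. \<Sum>l<n. cnj (u a i) * (?Q i j * z $ j * ?Q j l) * v b l)"
        by (simp only: mult.assoc)
    qed
    also have "\<dots> = (\<Sum>i<n. \<Sum>l<n. \<Sum>j<n. cnj (u a i) * (?Q i j * z $ j * ?Q j l) * v b l)"
      by (subst sum.swap) (intro sum.cong refl sum.swap)
    also have "\<dots> = (\<Sum>i<n. \<Sum>l<n. cnj (u a i) * Tmat n z $$ (i, l) * v b l)"
      by (intro sum.cong refl) (simp add: index_Tmat sum_distrib_left sum_distrib_right)
    finally show "(\<Sum>j<n. z $ j * \<alpha> a j * \<beta> b j) = (if a = b then of_real (\<sigma> a) else 0)"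
      using ab uv by simp
  next
    fix i j assume ij: "i \<in> {..<n}" "j \<in> {..<n}" "i \<noteq> j"
    note gram = Qmat_columns_gram[of i n j, folded k_def]
    show "(\<Sum>(a, b)\<in>{..<n} \<times> {..<n}. (cmod (\<alpha> a i * \<alpha> b j - \<alpha> a j * \<alpha> b i))\<^sup>2) \<le> 2 * k"
      using bessel_minors[of "{..<n}" "{..<n}" u "\<lambda>a. \<sigma> a \<noteq> 0" "\<lambda>l. ?Q l i" "\<lambda>l. ?Q l j"] u gram ij
      by (simp add: \<alpha>_def)
    \<comment> \<open>Conjugating an orthonormal family entrywise keeps it orthonormal; the inner
      products appear with \<open>a\<close> and \<open>b\<close> exchanged.\<close>
    have "(\<Sum>l<n. cnj (cnj (v a l)) * cnj (v b l)) = (if a = b then of_bool True else 0)"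
      if "a < n" "b < n" for a b
      using v[OF that(2,1)] by (simp add: mult.commute)
    then show "(\<Sum>(a, b)\<in>{..<n} \<times> {..<n}. (cmod (\<beta> a i * \<beta> b j - \<beta> a j * \<beta> b i))\<^sup>2) \<le> 2 * k"
      using bessel_minors[of "{..<n}" "{..<n}" "\<lambda>a l. cnj (v a l)" "\<lambda>_. True" "\<lambda>l. ?Q l i" "\<lambda>l. ?Q l j"] gram ij
      by (simp add: \<beta>_def)
  qed auto
  moreover have "(\<Sum>a<n. (\<sigma> a)\<^sup>2) \<le> k * (\<Sum>j<n. (cmod (z $ j))\<^sup>2)"
    using sq Tmat_frobenius[of n z] assms by (simp add: k_def)
  \<comment> \<open>Both bounds carry the same factor \<open>k\<close>, so the sums of squared
    moduli of \<open>z\<close> cancel.\<close>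
  ultimately have "(\<Sum>a<n. \<sigma> a)\<^sup>2 \<le> k * (\<Sum>j<n. cmod (z $ j))\<^sup>2"
    by (simp add: algebra_simps)
  then have "sqrt ((\<Sum>a<n. \<sigma> a)\<^sup>2) \<le> sqrt (k * (\<Sum>j<n. cmod (z $ j))\<^sup>2)"
    by (rule real_sqrt_le_mono)
  then have "\<bar>\<Sum>a<n. \<sigma> a\<bar> \<le> sqrt k * (\<Sum>j<n. cmod (z $ j))"
    by (simp add: real_sqrt_mult sum_nonneg)
  moreover have "k = (real n - 2) / real n" using assms(1) by (simp add: k_def field_simps)
  ultimately show ?thesis unfolding norm by simp
qed

end
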